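(* Let $X$ be a (real or complex) Banach space whose norm is Fréchet differentiable, let $(S,\Sigma,\mu)$ be a complete positive measure space, and let $1<p<\infty$. For $f,g\in L^{p}(\mu,X)$, $f\perp_{BJ}g$ in $L^{p}(\mu,X)$ if and only if $$\int_{Z(f)^c}\|f(s)\|^{p-1}F_{f(s)}(g(s))\,d\mu(s)=0.$$
   Context: For a normed space $E$ over $\mathbb{F}$ ($\mathbb{R}$ or $\mathbb{C}$) and $u,v\in E$, $u$ is Birkhoff-James orthogonal to $v$, written $u\perp_{BJ}v$, if $\|u+\lambda v\|\ge\|u\|$ for all $\lambda\in\mathbb{F}$. $L^{p}(\mu,X)$ is the Lebesgue-Bochner space of (classes modulo a.e. equality of) strongly measurable functions $f:S\to X$ with $\int_S\|f(s)\|^p\,d\mu(s)<\infty$, normed by $\|f\|=\big(\int_S\|f(s)\|^p\,d\mu(s)\big)^{1/p}$. The norm of $X$ is Fréchet differentiable if for every $0\neq x\in X$ there is a bounded real-linear functional $\varphi:X\to\mathbb{R}$ with $\lim_{h\to0}\frac{|\|x+h\|-\|x\|-\varphi(h)|}{\|h\|}=0$. For $0\neq x\in X$, a support map $F_x$ at $x$ is a bounded linear functional on $X$ (linear over the scalar field of $X$) with $\|F_x\|=1$ and $F_x(x)=\|x\|$; when the norm is Fréchet differentiable, $F_x$ is unique for each $x\neq0$. For a function $h:S\to X$, $Z(h)=\{s\in S:h(s)=0\}$ and $Z(h)^c$ is its complement in $S$. *)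

theory Defs
  imports "HOL-Analysis.Analysis"
begin

text \<open>The scalar field \<open>\<F>\<close>: a normed field that is isometrically isomorphic, as a field and
  over the reals, to the real or to the complex numbers.\<close>

class real_or_complex = real_normed_field + banach + second_countable_topology +
  assumes real_or_complex:
    "\<exists>\<phi> :: 'a \<Rightarrow> complex. (\<forall>a b. \<phi> (a + b) = \<phi> a + \<phi> b)
       \<and> (\<forall>r a. \<phi> (r *\<^sub>R a) = r *\<^sub>R \<phi> a) \<and> (\<forall>a b. \<phi> (a * b) = \<phi> a * \<phi> b)
       \<and> (\<forall>a. norm (\<phi> a) = norm a) \<and> (range \<phi> = \<real> \<or> range \<phi> = UNIV)"

instance real :: real_or_complex
proof
  show "\<exists>\<phi> :: real \<Rightarrow> complex. (\<forall>a b. \<phi> (a + b) = \<phi> a + \<phi> b)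
      \<and> (\<forall>r a. \<phi> (r *\<^sub>R a) = r *\<^sub>R \<phi> a) \<and> (\<forall>a b. \<phi> (a * b) = \<phi> a * \<phi> b)
      \<and> (\<forall>a. norm (\<phi> a) = norm a) \<and> (range \<phi> = \<real> \<or> range \<phi> = UNIV)"
    by (rule exI[of _ complex_of_real])
      (auto simp: Reals_def scaleR_conv_of_real)
qed

instance complex :: real_or_complex
proof
  show "\<exists>\<phi> :: complex \<Rightarrow> complex. (\<forall>a b. \<phi> (a + b) = \<phi> a + \<phi> b)
      \<and> (\<forall>r a. \<phi> (r *\<^sub>R a) = r *\<^sub>R \<phi> a) \<and> (\<forall>a b. \<phi> (a * b) = \<phi> a * \<phi> b)
      \<and> (\<forall>a. norm (\<phi> a) = norm a) \<and> (range \<phi> = \<real> \<or> range \<phi> = UNIV)"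
    by (rule exI[of _ "\<lambda>z. z"]) auto
qed

text \<open>A normed space over \<open>'k\<close> whose underlying real normed space is the one of the type \<open>'x\<close>.
  For \<open>'k = real\<close> the last axiom forces \<open>smul\<close> to be \<open>scaleR\<close>.\<close>

locale normed_space_over = vector_space smul
  for smul :: "'k::real_or_complex \<Rightarrow> 'x::real_normed_vector \<Rightarrow> 'x" +
  assumes norm_smul: "norm (smul c x) = norm c * norm x"
    and smul_of_real: "smul (of_real r) x = r *\<^sub>R x"

definition is_support_map ::
    "('k::real_or_complex \<Rightarrow> 'x::real_normed_vector \<Rightarrow> 'x) \<Rightarrow> 'x \<Rightarrow> ('x \<Rightarrow> 'k) \<Rightarrow> bool" where
  "is_support_map smul x \<phi> \<longleftrightarrow>
     bounded_linear \<phi> \<and> Vector_Spaces.linear smul (*) \<phi> \<and> onorm \<phi> = 1 \<and> \<phi> x = of_real (norm x)"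

text \<open>The library's \<open>borel_measurable\<close> is not adequate here, since \<open>'x\<close> need not be separable.\<close>

definition strongly_measurable :: "'s measure \<Rightarrow> ('s \<Rightarrow> 'x::real_normed_vector) \<Rightarrow> bool" where
  "strongly_measurable M f \<longleftrightarrow>
     (\<exists>t :: nat \<Rightarrow> 's \<Rightarrow> 'x. (\<forall>n. simple_function M (t n)) \<and> (AE s in M. (\<lambda>n. t n s) \<longlonglongrightarrow> f s))"

text \<open>Elements of the Lebesgue-Bochner space are given by representatives: no quotient by equality
  almost everywhere is formed, so \<open>Lp_norm\<close> is a seminorm on \<open>Lp_space\<close> that does not distinguish
  functions that are equal almost everywhere.\<close>

definition Lp_space :: "'s measure \<Rightarrow> real \<Rightarrow> ('s \<Rightarrow> 'x::real_normed_vector) set" where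
  "Lp_space M p = {f. strongly_measurable M f \<and> integrable M (\<lambda>s. norm (f s) powr p)}"

definition Lp_norm :: "'s measure \<Rightarrow> real \<Rightarrow> ('s \<Rightarrow> 'x::real_normed_vector) \<Rightarrow> real" where
  "Lp_norm M p f = (\<integral>s. norm (f s) powr p \<partial>M) powr (1 / p)"

definition Lp_BJ_orthogonal ::
    "('k::real_or_complex \<Rightarrow> 'x::real_normed_vector \<Rightarrow> 'x) \<Rightarrow> 's measure \<Rightarrow> real
      \<Rightarrow> ('s \<Rightarrow> 'x) \<Rightarrow> ('s \<Rightarrow> 'x) \<Rightarrow> bool" where
  "Lp_BJ_orthogonal smul M p f g \<longleftrightarrow>
     (\<forall>c. Lp_norm M p (\<lambda>s. f s + smul c (g s)) \<ge> Lp_norm M p f)"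

definition zero_set :: "'s measure \<Rightarrow> ('s \<Rightarrow> 'x::zero) \<Rightarrow> 's set" where
  "zero_set M h = {s \<in> space M. h s = 0}"

end

theory Submission
  imports Defs
begin

text \<open>Write \<open>W\<^sub>g s = \<parallel>f s\<parallel>\<^sup>p\<^sup>-\<^sup>1 Re (F\<^sub>f\<^sub>s (g s))\<close>. Differentiability of the norm forces its derivative at
  \<open>x \<noteq> 0\<close> to be \<open>Re F\<^sub>x\<close>, so \<open>p W\<^sub>g\<close> is the one-sided derivative at \<open>t = 0\<close> of the convex functions
  \<open>t \<mapsto> \<parallel>f s + t g s\<parallel>\<^sup>p\<close>. The tangent inequality shows that \<open>\<integral>W\<^sub>g \<ge> 0\<close> suffices for
  \<open>\<integral>\<parallel>f + g\<parallel>\<^sup>p \<ge> \<integral>\<parallel>f\<parallel>\<^sup>p\<close>. Conversely, by convexity the difference quotients for \<open>0 < t \<le> 1\<close> lie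
  between \<open>p W\<^sub>g\<close> and their value at \<open>t = 1\<close>, so dominated convergence gives \<open>\<integral>W\<^sub>g \<ge> 0\<close> from
  minimality of \<open>t \<mapsto> \<integral>\<parallel>f + t g\<parallel>\<^sup>p\<close> at \<open>0\<close>. Applying this to all scalar multiples of \<open>g\<close>, orthogonality
  means \<open>Re (c I) \<ge> 0\<close> for all scalars \<open>c\<close>, where \<open>I\<close> is the integral of the theorem, that is
  \<open>I = 0\<close>.\<close>

section \<open>Convexity and growth of real powers\<close>

lemma powr_above_tangent:
  fixes a y p :: real
  assumes "1 < p" "0 < a" "0 \<le> y"
  shows "a powr p + p * a powr (p - 1) * (y - a) \<le> y powr p"
\<comment> \<open>The second-derivative criterion is applied on the open half-line, so the endpoint
  0 is computed directly.\<close>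
proof (cases "y = 0")
  case True
  have "a powr p = a powr (p - 1) * a"
    using assms by (simp add: powr_diff)
  moreover have "0 \<le> (p - 1) * (a powr (p - 1) * a)"
    using assms by simp
  ultimately show ?thesis
    using True assms by (simp add: algebra_simps)
next
  case False
  have "(p * a powr (p - 1)) * (y - a) \<le> y powr p - a powr p"
  proof (rule f''_imp_f'[where C = "{0<..}" and f'' = "\<lambda>x. p * ((p - 1) * x powr (p - 1 - 1))"])
    show "((\<lambda>x. p * x powr (p - 1)) has_real_derivative p * ((p - 1) * x powr (p - 1 - 1))) (at x)"
      if "x \<in> {0<..}" for x :: real
      using that by (intro DERIV_cmult has_real_derivative_powr) auto
  qed (use False assms in \<open>auto intro: has_real_derivative_powr\<close>)
  then show ?thesis by simp
qed

text \<open>Average the tangent inequalities at the mean \<open>m\<close>: their first-order terms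
  cancel. A zero mean is treated apart because the tangent point must be positive.\<close>

lemma powr_convex_combination:
  fixes a b p t :: real
  assumes "1 < p" "0 \<le> a" "0 \<le> b" "0 \<le> t" "t \<le> 1"
  shows "((1 - t) * a + t * b) powr p \<le> (1 - t) * a powr p + t * b powr p"
proof (cases "(1 - t) * a + t * b = 0")
  case True
  then show ?thesis using assms by simp
next
  case False
  define m where "m = (1 - t) * a + t * b"
  have m: "0 < m" using False assms by (simp add: m_def order.not_eq_order_implies_strict)
  have "(1 - t) * (m powr p + p * m powr (p - 1) * (a - m)) \<le> (1 - t) * a powr p"
    "t * (m powr p + p * m powr (p - 1) * (b - m)) \<le> t * b powr p"
    using assms m by (auto intro!: mult_left_mono powr_above_tangent)
  moreover have "(1 - t) * (m powr p + p * m powr (p - 1) * (a - m))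
      + t * (m powr p + p * m powr (p - 1) * (b - m)) = m powr p"
    by (simp add: m_def algebra_simps)
  ultimately show ?thesis unfolding m_def by linarith
qed

lemma powr_add_le:
  fixes a b p :: real
  assumes "0 < p" "0 \<le> a" "0 \<le> b"
  shows "(a + b) powr p \<le> 2 powr p * (a powr p + b powr p)"
proof -
  have "(a + b) powr p \<le> (2 * max a b) powr p"
    using assms by (intro powr_mono2) auto
  also have "\<dots> = 2 powr p * max a b powr p"
    using assms by (simp add: powr_mult)
  also have "\<dots> \<le> 2 powr p * (a powr p + b powr p)"
    by (intro mult_left_mono) (auto simp: max_def)
  finally show ?thesis .
qed

text \<open>A crude form of Young's inequality, by replacing both factors with their maximum; it
  supplies the integrable majorant of the weight.\<close>

lemma powr_mult_le_add:
  fixes a b p :: real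
  assumes "1 < p" "0 \<le> a" "0 \<le> b"
  shows "a powr (p - 1) * b \<le> a powr p + b powr p"
proof -
  define m where "m = max a b"
  have "a powr (p - 1) * b \<le> m powr (p - 1) * m"
    using assms by (intro mult_mono powr_mono2) (auto simp: m_def)
  also have "\<dots> = m powr p"
  proof (cases "m = 0")
    case False
    then have "0 < m" using assms by (auto simp: m_def max_def split: if_splits)
    then show ?thesis by (simp add: powr_diff)
  qed simp
  also have "\<dots> \<le> a powr p + b powr p"
    by (auto simp: m_def max_def)
  finally show ?thesis .
qed

section \<open>Measurability over a complete measure and closure properties of Lp\<close>

lemma (in complete_measure) borel_measurable_AE_complete:
  assumes f: "f \<in> borel_measurable M" and ae: "AE x in M. f x = g x"
  shows "g \<in> borel_measurable M"
proof (rule measurableI)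
  fix A :: "'b set" assume A: "A \<in> sets borel"
  show "g -` A \<inter> space M \<in> sets M"
  proof (rule in_sets_AE)
    show "AE x in M. x \<in> f -` A \<inter> space M \<longleftrightarrow> x \<in> g -` A \<inter> space M"
      using ae by eventually_elim auto
    show "f -` A \<inter> space M \<in> sets M"
      using f A by (rule measurable_sets)
  qed auto
qed auto

text \<open>Overwriting all functions by one constant on the exceptional null set makes the
  convergence hold everywhere; completeness then transfers measurability back to \<open>f\<close>.
  The constant is arbitrary, since the target type need not have a zero.\<close>

lemma (in complete_measure) borel_measurable_AE_LIMSEQ:
  fixes f :: "'a \<Rightarrow> 'b::{second_countable_topology, metric_space}"
  assumes u: "\<And>n. u n \<in> borel_measurable M" and lim: "AE x in M. (\<lambda>n. u n x) \<longlonglongrightarrow> f x"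
  shows "f \<in> borel_measurable M"
proof -
  obtain N where N: "N \<in> null_sets M" "{x \<in> space M. \<not> (\<lambda>n. u n x) \<longlonglongrightarrow> f x} \<subseteq> N"
    using lim by (auto simp: eventually_ae_filter)
  have N_sets [measurable]: "N \<in> sets M" using N(1) by auto
  note u [measurable]
  define c :: 'b where "c = undefined"
  have "(\<lambda>x. if x \<in> N then c else f x) \<in> borel_measurable M"
  proof (rule borel_measurable_LIMSEQ_metric)
    show "(\<lambda>x. if x \<in> N then c else u n x) \<in> borel_measurable M" for n
      by measurable
    show "(\<lambda>n. if x \<in> N then c else u n x) \<longlonglongrightarrow> (if x \<in> N then c else f x)" if "x \<in> space M" for x
      using N(2) that by auto
  qed
  moreover have "AE x in M. (if x \<in> N then c else f x) = f x"
    using AE_not_in[OF N(1)] by eventually_elim auto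
  ultimately show ?thesis by (rule borel_measurable_AE_complete)
qed

lemma (in complete_measure) strongly_measurable_norm:
  assumes "strongly_measurable M f"
  shows "(\<lambda>s. norm (f s)) \<in> borel_measurable M"
proof -
  obtain t where t: "\<And>n. simple_function M (t n)" "AE s in M. (\<lambda>n. t n s) \<longlonglongrightarrow> f s"
    using assms by (auto simp: strongly_measurable_def)
  show ?thesis
  proof (rule borel_measurable_AE_LIMSEQ)
    show "(\<lambda>s. norm (t n s)) \<in> borel_measurable M" for n
      by (rule borel_measurable_simple_function[OF simple_function_compose1[OF t(1)]])
    show "AE s in M. (\<lambda>n. norm (t n s)) \<longlonglongrightarrow> norm (f s)"
      using t(2) by eventually_elim (rule tendsto_norm)
  qed
qed

lemma strongly_measurable_add:
  assumes "strongly_measurable M f" "strongly_measurable M g"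
  shows "strongly_measurable M (\<lambda>s. f s + g s)"
proof -
  obtain t where t: "\<And>n. simple_function M (t n)" "AE s in M. (\<lambda>n. t n s) \<longlonglongrightarrow> f s"
    using assms(1) by (auto simp: strongly_measurable_def)
  obtain u where u: "\<And>n. simple_function M (u n)" "AE s in M. (\<lambda>n. u n s) \<longlonglongrightarrow> g s"
    using assms(2) by (auto simp: strongly_measurable_def)
  have "simple_function M (\<lambda>s. t n s + u n s)" for n
    by (rule simple_function_compose2[OF t(1) u(1)])
  moreover have "AE s in M. (\<lambda>n. t n s + u n s) \<longlonglongrightarrow> f s + g s"
    using t(2) u(2) by eventually_elim (rule tendsto_add)
  ultimately show ?thesis
    unfolding strongly_measurable_def by (intro exI[of _ "\<lambda>n s. t n s + u n s"]) auto
qed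

lemma strongly_measurable_bounded_linear:
  assumes "bounded_linear T" "strongly_measurable M f"
  shows "strongly_measurable M (\<lambda>s. T (f s))"
proof -
  obtain t where t: "\<And>n. simple_function M (t n)" "AE s in M. (\<lambda>n. t n s) \<longlonglongrightarrow> f s"
    using assms(2) by (auto simp: strongly_measurable_def)
  have "simple_function M (\<lambda>s. T (t n s))" for n
    by (rule simple_function_compose1[OF t(1)])
  moreover have "AE s in M. (\<lambda>n. T (t n s)) \<longlonglongrightarrow> T (f s)"
    using t(2) by eventually_elim (rule bounded_linear.tendsto[OF assms(1)])
  ultimately show ?thesis
    unfolding strongly_measurable_def by (intro exI[of _ "\<lambda>n s. T (t n s)"]) auto
qed

lemma (in complete_measure) Lp_space_add:
  assumes "0 < p" "f \<in> Lp_space M p" "g \<in> Lp_space M p"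
  shows "(\<lambda>s. f s + g s) \<in> Lp_space M p"
proof -
  have sm: "strongly_measurable M (\<lambda>s. f s + g s)"
    using assms by (auto simp: Lp_space_def intro: strongly_measurable_add)
  have "integrable M (\<lambda>s. norm (f s + g s) powr p)"
  proof (rule Bochner_Integration.integrable_bound)
    show "integrable M (\<lambda>s. 2 powr p * (norm (f s) powr p + norm (g s) powr p))"
      using assms by (auto simp: Lp_space_def)
    show "(\<lambda>s. norm (f s + g s) powr p) \<in> borel_measurable M"
      using strongly_measurable_norm[OF sm] by measurable
    have "norm (f s + g s) powr p \<le> 2 powr p * (norm (f s) powr p + norm (g s) powr p)" for s
    proof -
      have "norm (f s + g s) powr p \<le> (norm (f s) + norm (g s)) powr p"
        using assms by (intro powr_mono2 norm_triangle_ineq) auto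
      also have "\<dots> \<le> 2 powr p * (norm (f s) powr p + norm (g s) powr p)"
        using assms by (intro powr_add_le) auto
      finally show ?thesis .
    qed
    then show "AE s in M. norm (norm (f s + g s) powr p)
        \<le> norm (2 powr p * (norm (f s) powr p + norm (g s) powr p))"
      by (auto simp: abs_mult)
  qed
  with sm show ?thesis by (simp add: Lp_space_def)
qed

text \<open>This form covers both real scaling and \<open>smul c\<close>.\<close>

lemma Lp_space_scaled_linear:
  assumes "bounded_linear T" "\<And>x. norm (T x) = k * norm x" "0 \<le> k" "f \<in> Lp_space M p"
  shows "(\<lambda>s. T (f s)) \<in> Lp_space M p"
  using assms by (auto simp: Lp_space_def powr_mult intro: strongly_measurable_bounded_linear)

section \<open>Derivatives of the norm and of its powers\<close>

text \<open>The function \<open>norm (x + t *\<^sub>R h) - t * D h\<close> is minimal at t = 0,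
  because \<open>D\<close> is dominated by the norm and attains it at \<open>x\<close>. Its
  derivative \<open>N h - D h\<close> there must vanish.\<close>

lemma differentiable_norm_has_directional_derivative:
  fixes x :: "'x::real_normed_vector" and D :: "'x \<Rightarrow> real"
  assumes diff: "norm differentiable (at x)"
    and D: "linear D" "\<And>y. D y \<le> norm y" "D x = norm x"
  shows "((\<lambda>t. norm (x + t *\<^sub>R h)) has_real_derivative D h) (at 0)"
proof -
  obtain N where N: "(norm has_derivative N) (at x)"
    using diff by (auto simp: differentiable_def)
  interpret N: bounded_linear N using N by (rule has_derivative_bounded_linear)
  have "((\<lambda>t. x + t *\<^sub>R h) has_derivative (\<lambda>t. t *\<^sub>R h)) (at 0)"
    by (auto intro!: derivative_eq_intros)
  moreover have "(norm has_derivative N) (at (x + 0 *\<^sub>R h))" using N by simp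
  ultimately have "((\<lambda>t. norm (x + t *\<^sub>R h)) has_derivative (\<lambda>t. N (t *\<^sub>R h))) (at 0)"
    by (rule has_derivative_compose)
  then have der: "((\<lambda>t. norm (x + t *\<^sub>R h)) has_real_derivative N h) (at 0)"
    by (rule has_derivative_imp_has_field_derivative) (simp add: N.scaleR)
  have "((\<lambda>t. norm (x + t *\<^sub>R h) - t * D h) has_real_derivative N h - D h) (at 0)"
    by (rule derivative_eq_intros der refl | simp)+
  moreover have "norm (x + 0 *\<^sub>R h) - 0 * D h \<le> norm (x + t *\<^sub>R h) - t * D h" for t
    using D(2)[of "x + t *\<^sub>R h"] D(3) by (simp add: linear_add[OF D(1)] linear_cmul[OF D(1)])
  ultimately have "N h - D h = 0"
    by (intro DERIV_local_min[where d = 1]) auto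
  with der show ?thesis by simp
qed

text \<open>\<open>D x\<close> stands for the real part of the support map at \<open>x\<close>, so
  the analysis here is purely real. \<open>D 0\<close> is arbitrary: the weight
  \<open>norm x powr (p - 1) * D x y\<close> vanishes at x = 0.\<close>

locale smooth_support = complete_measure M
  for M :: "'s measure" +
  fixes p :: real and D :: "'x::real_normed_vector \<Rightarrow> 'x \<Rightarrow> real"
  assumes p: "1 < p"
    and norm_differentiable: "x \<noteq> 0 \<Longrightarrow> norm differentiable (at (x :: 'x))"
    and D_linear: "x \<noteq> 0 \<Longrightarrow> linear (D x)"
    and D_le: "x \<noteq> 0 \<Longrightarrow> D x y \<le> norm y"
    and D_self: "x \<noteq> 0 \<Longrightarrow> D x x = norm x"
begin

lemma D_abs_le: "\<bar>D x y\<bar> \<le> norm y" if "x \<noteq> 0"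
  using D_le[OF that, of y] D_le[OF that, of "- y"] linear_neg[OF D_linear[OF that]]
  by (simp add: abs_le_iff)

lemma weight_abs_le: "\<bar>norm x powr (p - 1) * D x y\<bar> \<le> norm x powr p + norm y powr p"
proof (cases "x = 0")
  case False
  have "\<bar>norm x powr (p - 1) * D x y\<bar> \<le> norm x powr (p - 1) * norm y"
    using D_abs_le[OF False] by (simp add: abs_mult mult_left_mono)
  also have "\<dots> \<le> norm x powr p + norm y powr p"
    using p by (intro powr_mult_le_add) auto
  finally show ?thesis .
qed simp

text \<open>Combines the scalar tangent inequality at \<open>norm x\<close> with
  \<open>norm x + D x y \<le> norm (x + y)\<close>.\<close>

lemma norm_powr_above_tangent:
  "norm x powr p + p * (norm x powr (p - 1) * D x y) \<le> norm (x + y) powr p"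
proof (cases "x = 0")
  case False
  have "norm x + D x y \<le> norm (x + y)"
    using D_le[OF False, of "x + y"] D_self[OF False] by (simp add: linear_add[OF D_linear[OF False]])
  then have "p * norm x powr (p - 1) * D x y \<le> p * norm x powr (p - 1) * (norm (x + y) - norm x)"
    using p by (intro mult_left_mono) auto
  moreover have "norm x powr p + p * norm x powr (p - 1) * (norm (x + y) - norm x) \<le> norm (x + y) powr p"
    using p False by (intro powr_above_tangent) auto
  ultimately show ?thesis by (simp add: mult.assoc)
qed simp

lemma norm_powr_difference_quotient_le:
  assumes "0 < t" "t \<le> 1"
  shows "(norm (x + t *\<^sub>R y) powr p - norm x powr p) / t \<le> norm (x + y) powr p - norm x powr p"
proof -
  \<comment> \<open>Viewing the point as a convex combination of x and x + y makes the quotient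
    bound an instance of convexity.\<close>
  have "x + t *\<^sub>R y = (1 - t) *\<^sub>R x + t *\<^sub>R (x + y)"
    by (simp add: algebra_simps)
  then have "norm (x + t *\<^sub>R y) \<le> (1 - t) * norm x + t * norm (x + y)"
    using norm_triangle_ineq[of "(1 - t) *\<^sub>R x" "t *\<^sub>R (x + y)"] assms by simp
  then have "norm (x + t *\<^sub>R y) powr p \<le> ((1 - t) * norm x + t * norm (x + y)) powr p"
    using p by (intro powr_mono2) auto
  also have "\<dots> \<le> (1 - t) * norm x powr p + t * norm (x + y) powr p"
    using p assms by (intro powr_convex_combination) auto
  finally show ?thesis using assms by (simp add: field_simps)
qed

lemma norm_powr_difference_quotient_ge:
  assumes "0 < t"
  shows "p * (norm x powr (p - 1) * D x y) \<le> (norm (x + t *\<^sub>R y) powr p - norm x powr p) / t"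
proof (cases "x = 0")
  case False
  then show ?thesis
    using norm_powr_above_tangent[of x "t *\<^sub>R y"] assms
    by (simp add: linear_cmul[OF D_linear] field_simps)
qed (use assms in simp)

text \<open>Away from 0 this is the chain rule. At x = 0 the quotient equals
  \<open>t powr (p - 1) * norm y powr p\<close>, which tends to 0 because p > 1.\<close>

lemma norm_powr_has_right_derivative:
  "((\<lambda>t. (norm (x + t *\<^sub>R y) powr p - norm x powr p) / t) \<longlongrightarrow> p * (norm x powr (p - 1) * D x y))
    (at_right 0)"
proof (cases "x = 0")
  case True
  have "((\<lambda>t. t powr (p - 1) * norm y powr p) \<longlongrightarrow> 0) (at_right 0)"
  proof -
    have "((\<lambda>t::real. t powr (p - 1)) \<longlongrightarrow> 0 powr (p - 1)) (at_right 0)"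
      using p by (intro tendsto_powr' tendsto_ident_at tendsto_const)
        (auto simp: eventually_at_filter)
    then show ?thesis by (intro tendsto_mult_left_zero) simp
  qed
  moreover have "eventually (\<lambda>t. t powr (p - 1) * norm y powr p
      = (norm (x + t *\<^sub>R y) powr p - norm x powr p) / t) (at_right 0)"
    using eventually_at_right_less[of 0]
    by eventually_elim (simp add: True powr_mult powr_diff)
  ultimately show ?thesis
    using True by (simp add: tendsto_cong)
next
  case False
  have "((\<lambda>t. norm (x + t *\<^sub>R y)) has_real_derivative D x y) (at 0)"
    using False D_linear D_le D_self norm_differentiable
    by (intro differentiable_norm_has_directional_derivative) auto
  from DERIV_fun_powr[OF this, of p] False
  have "((\<lambda>t. norm (x + t *\<^sub>R y) powr p) has_real_derivative p * (norm x powr (p - 1) * D x y)) (at 0)"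
    by (simp add: mult.assoc)
  then have "((\<lambda>t. (norm (x + t *\<^sub>R y) powr p - norm x powr p) / t)
      \<longlongrightarrow> p * (norm x powr (p - 1) * D x y)) (at 0)"
    by (simp add: has_field_derivative_iff)
  then show ?thesis by (rule filterlim_mono) (auto simp: at_le)
qed

text \<open>Measurability of limits and dominated convergence call for a sequence;
  \<open>Suc n\<close> keeps the step in (0, 1], where the upper quotient bound applies.\<close>

lemma norm_powr_difference_quotient_LIMSEQ:
  "(\<lambda>n. (norm (x + (1 / real (Suc n)) *\<^sub>R y) powr p - norm x powr p) / (1 / real (Suc n)))
    \<longlonglongrightarrow> p * (norm x powr (p - 1) * D x y)"
proof -
  have "filterlim (\<lambda>n. 1 / real (Suc n)) (at_right 0) sequentially"
    unfolding filterlim_at by (auto intro: LIMSEQ_Suc lim_1_over_n simp del: of_nat_Suc)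
  from filterlim_compose[OF norm_powr_has_right_derivative this] show ?thesis .
qed

section \<open>Integrating the pointwise estimates\<close>

context
  fixes f g :: "'s \<Rightarrow> 'x"
  assumes f: "f \<in> Lp_space M p" and g: "g \<in> Lp_space M p"
begin

lemma Lp_add_scaleR: "(\<lambda>s. f s + t *\<^sub>R g s) \<in> Lp_space M p"
  using p by (intro Lp_space_add[OF _ f]
      Lp_space_scaled_linear[OF bounded_linear_scaleR_right[of t] norm_scaleR abs_ge_zero g]) simp

lemma integrable_norm_powr: "integrable M (\<lambda>s. norm (f s) powr p)"
  "integrable M (\<lambda>s. norm (g s) powr p)"
  "integrable M (\<lambda>s. norm (f s + t *\<^sub>R g s) powr p)"
  using f g Lp_add_scaleR[of t] by (auto simp: Lp_space_def)

text \<open>No measurability of \<open>D\<close> in its first argument is assumed; the weight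
  inherits it as a pointwise limit of measurable difference quotients.\<close>

lemma weight_measurable: "(\<lambda>s. norm (f s) powr (p - 1) * D (f s) (g s)) \<in> borel_measurable M"
proof -
  have "(\<lambda>s. p * (norm (f s) powr (p - 1) * D (f s) (g s))) \<in> borel_measurable M"
    by (rule borel_measurable_LIMSEQ_metric[OF _ norm_powr_difference_quotient_LIMSEQ])
      (use borel_measurable_integrable[OF integrable_norm_powr(1)]
          borel_measurable_integrable[OF integrable_norm_powr(3)] in measurable)
  from borel_measurable_times[OF borel_measurable_const this]
  have "(\<lambda>s. (1 / p) * (p * (norm (f s) powr (p - 1) * D (f s) (g s)))) \<in> borel_measurable M" .
  then show ?thesis using p by simp
qed

lemma weight_integrable: "integrable M (\<lambda>s. norm (f s) powr (p - 1) * D (f s) (g s))"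
proof (rule Bochner_Integration.integrable_bound[OF _ weight_measurable])
  show "integrable M (\<lambda>s. norm (f s) powr p + norm (g s) powr p)"
    by (intro Bochner_Integration.integrable_add integrable_norm_powr)
qed (use weight_abs_le in auto)

lemma integral_norm_powr_above_tangent:
  "(\<integral>s. norm (f s) powr p \<partial>M) + p * (\<integral>s. norm (f s) powr (p - 1) * D (f s) (g s) \<partial>M)
    \<le> (\<integral>s. norm (f s + g s) powr p \<partial>M)"
proof -
  have "(\<integral>s. norm (f s) powr p + p * (norm (f s) powr (p - 1) * D (f s) (g s)) \<partial>M)
      \<le> (\<integral>s. norm (f s + g s) powr p \<partial>M)"
    using integrable_norm_powr(1) integrable_norm_powr(3)[of 1] weight_integrable
    by (intro integral_mono norm_powr_above_tangent) auto
  then show ?thesis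
    using integrable_norm_powr(1) weight_integrable by simp
qed

lemma integral_weight_nonneg:
  assumes min: "\<And>t. (\<integral>s. norm (f s) powr p \<partial>M) \<le> (\<integral>s. norm (f s + t *\<^sub>R g s) powr p \<partial>M)"
  shows "0 \<le> (\<integral>s. norm (f s) powr (p - 1) * D (f s) (g s) \<partial>M)"
proof -
  define Q where "Q n s = (norm (f s + (1 / real (Suc n)) *\<^sub>R g s) powr p - norm (f s) powr p)
      / (1 / real (Suc n))" for n s
  define W where "W s = p * (norm (f s) powr (p - 1) * D (f s) (g s))" for s
  define B where "B s = norm (f s + g s) powr p - norm (f s) powr p" for s
  have Q_int: "integrable M (Q n)" for n
    unfolding Q_def using integrable_norm_powr by (intro integrable_divide Bochner_Integration.integrable_diff) auto
  have W_int: "integrable M W"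
    unfolding W_def using weight_integrable by (intro integrable_mult_right)
  have B_int: "integrable M B"
    unfolding B_def using integrable_norm_powr(1) integrable_norm_powr(3)[of 1] by simp
  have "W s \<le> Q n s" "Q n s \<le> B s" for n s
    unfolding W_def Q_def B_def
    by (rule norm_powr_difference_quotient_ge norm_powr_difference_quotient_le; simp)+
  then have "\<bar>Q n s\<bar> \<le> \<bar>W s\<bar> + \<bar>B s\<bar>" for n s
    by (smt (verit))
  moreover have "(\<lambda>n. Q n s) \<longlonglongrightarrow> W s" for s
    unfolding Q_def W_def by (rule norm_powr_difference_quotient_LIMSEQ)
  ultimately have "(\<lambda>n. integral\<^sup>L M (Q n)) \<longlonglongrightarrow> integral\<^sup>L M W"
    using W_int B_int Q_int
    by (intro integral_dominated_convergence[where w = "\<lambda>s. \<bar>W s\<bar> + \<bar>B s\<bar>"]) auto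
  moreover have "0 \<le> integral\<^sup>L M (Q n)" for n
    unfolding Q_def using integrable_norm_powr min[of "1 / real (Suc n)"] by simp
  ultimately have "0 \<le> integral\<^sup>L M W"
    by (intro LIMSEQ_le_const) auto
  then show ?thesis
    using p by (simp add: W_def[abs_def] zero_le_mult_iff)
qed

end

end

section \<open>Real parts of scalars and the orthogonality criterion\<close>

text \<open>The scalar \<open>j\<close> is the imaginary unit in the complex case and \<open>0\<close> in the real case.\<close>

lemma real_part_exists:
  "\<exists>(re :: 'k::real_or_complex \<Rightarrow> real) j. bounded_linear re \<and> (\<forall>a. re a \<le> norm a)
    \<and> (\<forall>r. re (of_real r) = r) \<and> (\<forall>a. a = re a *\<^sub>R 1 - re (j * a) *\<^sub>R j)"
proof -
  obtain \<phi> :: "'k \<Rightarrow> complex" where add: "\<And>a b. \<phi> (a + b) = \<phi> a + \<phi> b"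
    and scale: "\<And>r a. \<phi> (r *\<^sub>R a) = r *\<^sub>R \<phi> a" and mult: "\<And>a b. \<phi> (a * b) = \<phi> a * \<phi> b"
    and norm: "\<And>a. norm (\<phi> a) = norm a" and range: "range \<phi> = \<real> \<or> range \<phi> = UNIV"
    using real_or_complex[where 'a = 'k] by blast
  have bl: "bounded_linear \<phi>"
    by (rule bounded_linear_intro[where K = 1]) (auto simp: add scale norm)
  interpret \<phi>: bounded_linear \<phi> by (rule bl)
  \<comment> \<open>\<open>\<phi> 1\<close> is idempotent and has norm 1, hence is not 0.\<close>
  have one: "\<phi> 1 = 1"
    using mult[of 1 1] norm[of 1] by auto
  have inj: "a = b" if "\<phi> a = \<phi> b" for a b
    using norm[of "a - b"] that by (simp add: \<phi>.diff)
  obtain j where j: "(j = 0 \<and> range \<phi> = \<real>) \<or> \<phi> j = \<i>"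
    using range by (metis surjD)
  show ?thesis
  proof (intro exI[of _ "\<lambda>a. Re (\<phi> a)"] exI[of _ j] conjI allI)
    show "bounded_linear (\<lambda>a. Re (\<phi> a))"
      using bounded_linear_compose[OF bounded_linear_Re bl] by (simp add: o_def)
    show "Re (\<phi> a) \<le> norm a" for a
      using complex_Re_le_cmod[of "\<phi> a"] norm by simp
    show "Re (\<phi> (of_real r)) = r" for r
      by (simp add: of_real_def scale one)
    \<comment> \<open>In the complex case Re (i z) = - Im z; in the real case the second term
      vanishes.\<close>
    show "a = Re (\<phi> a) *\<^sub>R 1 - Re (\<phi> (j * a)) *\<^sub>R j" for a
    proof (rule inj, cases "j = 0")
      case True
      then have "\<phi> a \<in> \<real>" using j by auto
      then show "\<phi> a = \<phi> (Re (\<phi> a) *\<^sub>R 1 - Re (\<phi> (j * a)) *\<^sub>R j)"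
        using True by (simp add: scale one \<phi>.zero complex_eq_iff complex_is_Real_iff)
    next
      case False
      then have "\<phi> j = \<i>" using j by auto
      then show "\<phi> a = \<phi> (Re (\<phi> a) *\<^sub>R 1 - Re (\<phi> (j * a)) *\<^sub>R j)"
        using scale one by (simp add: \<phi>.diff \<phi>.add mult complex_eq_iff)
    qed
  qed
qed

text \<open>The integrability conjunct gives the equation its meaning, as the integral of a
  non-integrable function is 0 by convention.\<close>

theorem corollary3p7:
  fixes M :: "'s measure" and p :: real
    and smul :: "'k::real_or_complex \<Rightarrow> 'x::banach \<Rightarrow> 'x"
    and F :: "'x \<Rightarrow> 'x \<Rightarrow> 'k"
    and f g :: "'s \<Rightarrow> 'x"
  assumes "normed_space_over smul"
    and "\<And>x::'x. x \<noteq> 0 \<Longrightarrow> norm differentiable (at x)"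
    and "\<And>x::'x. x \<noteq> 0 \<Longrightarrow> is_support_map smul x (F x)"
    and "complete_measure M"
    and "1 < p"
    and "f \<in> Lp_space M p" and "g \<in> Lp_space M p"
  shows "set_integrable M (space M - zero_set M f)
           (\<lambda>s. norm (f s) powr (p - 1) *\<^sub>R F (f s) (g s))
       \<and> (Lp_BJ_orthogonal smul M p f g \<longleftrightarrow>
           (LINT s:space M - zero_set M f|M. norm (f s) powr (p - 1) *\<^sub>R F (f s) (g s)) = 0)"
proof -
  interpret normed_space_over smul by (rule assms(1))
  obtain re :: "'k \<Rightarrow> real" and j where re: "bounded_linear re" "\<And>a. re a \<le> norm a"
    "\<And>r. re (of_real r) = r" "\<And>a. a = re a *\<^sub>R 1 - re (j * a) *\<^sub>R j"
    using real_part_exists[where 'k = 'k] by blast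
  interpret re: bounded_linear re by (rule re(1))
  have F: "bounded_linear (F x)" "F x (smul c y) = c * F x y" "norm (F x y) \<le> norm y"
    "F x x = of_real (norm x)" if "x \<noteq> 0" for x y c
  proof -
    note * = assms(3)[OF that, unfolded is_support_map_def]
    show "bounded_linear (F x)" "F x x = of_real (norm x)" using * by auto
    show "F x (smul c y) = c * F x y" using * by (auto simp: Vector_Spaces.linear_iff)
    show "norm (F x y) \<le> norm y" using * onorm[of "F x" y] by auto
  qed
  interpret smooth_support M p "\<lambda>x y. re (F x y)"
  proof (intro smooth_support.intro smooth_support_axioms.intro)
    fix x y :: 'x assume x: "x \<noteq> 0"
    show "linear (\<lambda>y. re (F x y))"
      using bounded_linear_compose[OF re(1) F(1)[OF x]] by (rule bounded_linear.linear)
    show "re (F x y) \<le> norm y" using re(2) F(3)[OF x] by (rule order_trans)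
    show "re (F x x) = norm x" using F(4)[OF x] re(3) by simp
  qed (use assms in auto)
  define h where "h s = norm (f s) powr (p - 1) *\<^sub>R F (f s) (g s)" for s
  have smul_linear: "bounded_linear (smul c)" for c
  proof (rule bounded_linear_intro[where K = "norm c"])
    show "smul c (r *\<^sub>R x) = r *\<^sub>R smul c x" for r x
      using scale_left_commute[of c "of_real r" x] unfolding smul_of_real .
  qed (auto simp: scale_right_distrib norm_smul)
  have cg: "(\<lambda>s. smul c (g s)) \<in> Lp_space M p" for c
    using Lp_space_scaled_linear[OF smul_linear norm_smul] assms(7) by auto
  \<comment> \<open>Where \<open>f s = 0\<close> both sides vanish whatever \<open>F 0\<close> is;
    elsewhere linearity of the support map pulls \<open>c\<close> out.\<close>
  have weight: "norm (f s) powr (p - 1) * re (F (f s) (smul c (g s))) = re (c * h s)" for c s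
    by (cases "f s = 0") (auto simp: h_def F re.scaleR re.zero)
  have re_int: "integrable M (\<lambda>s. re (c * h s))" for c
    using weight_integrable[OF assms(6) cg[of c]] by (simp add: weight)
  \<comment> \<open>The real parts of \<open>h\<close> and \<open>j * h\<close> are integrable and
    rebuild \<open>h\<close>.\<close>
  have h_int: "integrable M h"
  proof -
    have "integrable M (\<lambda>s. re (1 * h s) *\<^sub>R 1 - re (j * h s) *\<^sub>R j)"
      by (intro Bochner_Integration.integrable_diff integrable_scaleR_left re_int)
    then show ?thesis using re(4) by simp
  qed
  have h_set: "indicator (space M - zero_set M f) s *\<^sub>R h s = h s" if "s \<in> space M" for s
    using that by (auto simp: h_def zero_set_def indicator_def)
  define I where "I = integral\<^sup>L M h"
  have re_I: "(\<integral>s. norm (f s) powr (p - 1) * re (F (f s) (smul c (g s))) \<partial>M) = re (c * I)" for c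
  proof -
    have "(\<integral>s. re (c * h s) \<partial>M) = re (\<integral>s. c * h s \<partial>M)"
      by (rule integral_bounded_linear[OF re(1) integrable_mult_right[OF h_int]])
    then show ?thesis unfolding weight by (simp add: I_def)
  qed
  have orth: "Lp_BJ_orthogonal smul M p f g \<longleftrightarrow>
      (\<forall>c. (\<integral>s. norm (f s) powr p \<partial>M) \<le> (\<integral>s. norm (f s + smul c (g s)) powr p \<partial>M))"
  proof -
    \<comment> \<open>Strict monotonicity of the p-th root lets norms be compared through their p-th
      powers.\<close>
    have "a powr (1 / p) \<le> b powr (1 / p) \<longleftrightarrow> a \<le> b" if "0 \<le> a" "0 \<le> b" for a b :: real
      using powr_mono2[of "1 / p" a b] powr_less_mono2[of "1 / p" b a] p that
      by (auto simp flip: not_less)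
    then show ?thesis
      unfolding Lp_BJ_orthogonal_def Lp_norm_def by (intro all_cong1) simp
  qed
  have "Lp_BJ_orthogonal smul M p f g \<longleftrightarrow> I = 0"
  proof
    assume "Lp_BJ_orthogonal smul M p f g"
    then have min: "(\<integral>s. norm (f s) powr p \<partial>M) \<le> (\<integral>s. norm (f s + smul c (g s)) powr p \<partial>M)" for c
      using orth by blast
    have nonneg: "0 \<le> re (c * I)" for c
      unfolding re_I[symmetric]
    proof (rule integral_weight_nonneg[OF assms(6) cg])
      show "(\<integral>s. norm (f s) powr p \<partial>M) \<le> (\<integral>s. norm (f s + t *\<^sub>R smul c (g s)) powr p \<partial>M)" for t
        \<comment> \<open>A real multiple of \<open>smul c (g s)\<close> is again a scalar multiple
          of \<open>g s\<close>, so minimality along every real line follows.\<close>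
        using min[of "of_real t * c"] by (simp add: smul_of_real flip: scale_scale)
    qed
    \<comment> \<open>Using both \<open>c\<close> and \<open>- c\<close> turns the inequality into
      an equality; the scalars 1 and \<open>j\<close> then recover \<open>I\<close>.\<close>
    have "re (c * I) = 0" for c
      using nonneg[of c] nonneg[of "- c"] by (simp add: re.neg)
    from this[of 1] this[of j] show "I = 0"
      using re(4)[of I] by simp
  next
    assume "I = 0"
    then show "Lp_BJ_orthogonal smul M p f g"
      unfolding orth
      using integral_norm_powr_above_tangent[OF assms(6) cg] by (simp add: re_I re.zero)
  qed
  moreover have "set_integrable M (space M - zero_set M f) h"
    unfolding set_integrable_def using h_int h_set
    by (simp cong: Bochner_Integration.integrable_cong)
  moreover have "(LINT s:space M - zero_set M f|M. h s) = I"
    unfolding set_lebesgue_integral_def I_def using h_set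
    by (intro Bochner_Integration.integral_cong) auto
  ultimately show ?thesis unfolding h_def by simp
qed

end
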